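(* Consider the system of $N$ pulse-coupled oscillators with delayed excitatory coupling described in the context, with $0<\tau<1$, $0<\varepsilon<1$ and $f(\tau)+\varepsilon<1$. If a solution $[\phi_1(t),\dots,\phi_N(t)]$ of the system is a completely synchronized solution, then it is a period-one solution (i.e. a period-$d$ solution with $d=1$).
   Context: The system: $N$ identical oscillators $i=1,\dots,N$ have phases $\phi_i(t)\in[0,1]$, $t\ge 0$. $\mathrm{Pre}(i)$ is the set of oscillators sending pulses to $i$, and $\mathrm{Post}(i)$ is the set of oscillators receiving pulses from $i$ (so $j\in\mathrm{Post}(i)$ iff $i\in\mathrm{Pre}(j)$). The function $f:[0,1]\to[0,1]$ is twice continuously differentiable with $f'>0$, $f''<0$, $f(0)=0$, $f(1)=1$. Dynamics: (1) In the absence of interaction, $\mathrm{d}\phi_i/\mathrm{d}t=1$. (2) When $\phi_i(t)=1$, oscillator $i$ fires at time $t$ and its phase is reset instantly: $\phi_i(t^+)=0$. (3) If oscillator $i$ fires at time $t$, it emits a spike, which reaches every $j\in\mathrm{Post}(i)$ at time $t+\tau$ and induces the phase jump $\phi_j(t+\tau)=f^{-1}(\min[1,f(\phi_j((t+\tau)^-))+\varepsilon_{ij}])$, where $\varepsilon_{ij}>0$ is the coupling strength from $i$ to $j$. If several spikes reach $j$ at the same time, their strengths are added in this formula. (A phase brought to $1$ by a jump at time $s$ means that the oscillator fires at time $s$.) Standing assumptions: the system starts at time $t=0$ with initial phases $0<\phi_i(0)\le 1$, and no spikes emitted before time $0$ are present; there is no self-interaction, i.e. $i\notin\mathrm{Pre}(i)$;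 $0<\tau<1$; and for all $i$, $\sum_{j\in\mathrm{Pre}(i)}\varepsilon_{ji}=\varepsilon$ with $0<\varepsilon<1$. $t^i_m$ denotes the time at which oscillator $i$ fires for the $m$-th time ($m\ge1$). A solution is a period-$d$ solution if there exist $\Delta t_0>0$ and positive integers $M$ and $d$ such that the firing times of every oscillator $i$ satisfy $t^i_{m+d}-t^i_m=\Delta t_0$ for all $m\ge M$. A solution is completely synchronized if there exists $T\ge 0$ such that $\phi_i(t)=\phi_j(t)$ for all oscillators $i,j$ and all $t\ge T$. *)

theory Defs
  imports Complex_Main
begin

definition rise_function :: "(real \<Rightarrow> real) \<Rightarrow> bool" where
  "rise_function f \<longleftrightarrow>
     f ` {0..1} \<subseteq> {0..1} \<and> f 0 = 0 \<and> f 1 = 1 \<and>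
     (\<exists>f' f''.
        (\<forall>x\<in>{0..1}. (f has_real_derivative f' x) (at x within {0..1}) \<and>
                     (f' has_real_derivative f'' x) (at x within {0..1}) \<and>
                     f' x > 0 \<and> f'' x < 0) \<and>
        continuous_on {0..1} f'')"

text \<open>The value of a phase at an instant of discontinuity is the one reached by the jump, so an
  oscillator fires exactly when its phase has the value 1; the reset to 0 is only visible in the
  right limit.  The bound \<open>0 \<le> t\<close> excludes spikes emitted before time 0.\<close>

definition fires :: "('n \<Rightarrow> real \<Rightarrow> real) \<Rightarrow> 'n \<Rightarrow> real \<Rightarrow> bool" where
  "fires \<phi> i t \<longleftrightarrow> 0 \<le> t \<and> \<phi> i t = 1"

definition arriving ::
  "('n \<Rightarrow> 'n set) \<Rightarrow> real \<Rightarrow> ('n \<Rightarrow> real \<Rightarrow> real) \<Rightarrow> 'n \<Rightarrow> real \<Rightarrow> 'n set" where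
  "arriving Pre \<tau> \<phi> i t = {j \<in> Pre i. fires \<phi> j (t - \<tau>)}"

text \<open>\<open>eps j i\<close> is the strength of the coupling from \<open>j\<close> to \<open>i\<close>.  In the clause for the left limit,
  the sum is 0 if no spike arrives, and the clause then says that \<open>\<phi> i\<close> is left continuous
  at \<open>t\<close>.  The existence of one-sided limits at every time makes the firing times locally finite.\<close>

definition pulse_solution ::
  "(real \<Rightarrow> real) \<Rightarrow> real \<Rightarrow> ('n \<Rightarrow> 'n set) \<Rightarrow> ('n \<Rightarrow> 'n \<Rightarrow> real) \<Rightarrow> ('n \<Rightarrow> real \<Rightarrow> real) \<Rightarrow> bool" where
  "pulse_solution f \<tau> Pre eps \<phi> \<longleftrightarrow>
     (\<forall>i. 0 < \<phi> i 0 \<and> \<phi> i 0 \<le> 1) \<and>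
     (\<forall>i. \<forall>t\<ge>0. 0 \<le> \<phi> i t \<and> \<phi> i t \<le> 1) \<and>
     (\<forall>i. \<forall>t>0. \<not> fires \<phi> i t \<and> arriving Pre \<tau> \<phi> i t = {} \<longrightarrow>
        (\<phi> i has_real_derivative 1) (at t)) \<and>
     (\<forall>i. \<forall>t\<ge>0. (\<phi> i \<longlongrightarrow> (if fires \<phi> i t then 0 else \<phi> i t)) (at_right t)) \<and>
     (\<forall>i. \<forall>t>0. \<exists>l. (\<phi> i \<longlongrightarrow> l) (at_left t) \<and>
        \<phi> i t = the_inv_into {0..1} f
                  (min 1 (f l + (\<Sum>j\<in>arriving Pre \<tau> \<phi> i t. eps j i))))"

definition is_firing_time :: "('n \<Rightarrow> real \<Rightarrow> real) \<Rightarrow> 'n \<Rightarrow> nat \<Rightarrow> real \<Rightarrow> bool" where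
  "is_firing_time \<phi> i m t \<longleftrightarrow>
     fires \<phi> i t \<and> finite {s. s \<le> t \<and> fires \<phi> i s} \<and> card {s. s \<le> t \<and> fires \<phi> i s} = m"

text \<open>The firing times referred to are required to exist.\<close>

definition period_solution :: "nat \<Rightarrow> ('n \<Rightarrow> real \<Rightarrow> real) \<Rightarrow> bool" where
  "period_solution d \<phi> \<longleftrightarrow> d > 0 \<and>
     (\<exists>\<Delta>>0. \<exists>M>0. \<forall>i. \<forall>m\<ge>M. \<exists>t t'.
        is_firing_time \<phi> i m t \<and> is_firing_time \<phi> i (m + d) t' \<and> t' - t = \<Delta>)"

definition completely_synchronized :: "('n \<Rightarrow> real \<Rightarrow> real) \<Rightarrow> bool" where
  "completely_synchronized \<phi> \<longleftrightarrow> (\<exists>T\<ge>0. \<forall>i j. \<forall>t\<ge>T. \<phi> i t = \<phi> j t)"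

end

theory Submission
  imports Defs
begin

text \<open>By concavity of \<open>f\<close> and \<open>f \<tau> + \<epsilon> < 1\<close>, a synchronized population that has just fired needs at
  least two spikes to fire again within a delay \<open>\<tau>\<close>.  Such a firing consumes two spikes in flight
  and emits one, so the number of spikes in flight drops, and some gap between firings eventually
  exceeds \<open>\<tau>\<close>.  From then on the only spike in flight is the last one emitted; it arrives at
  phase \<open>\<tau>\<close>, moves it to \<open>c\<close> with \<open>f c = f \<tau> + \<epsilon>\<close>, and the gap is \<open>\<tau> + 1 - c > \<tau>\<close> forever.\<close>

section \<open>Rise functions\<close>

lemma rise_functionE:
  assumes "rise_function f"
  obtains f' f'' where "\<And>x. x \<in> {0..1} \<Longrightarrow> (f has_real_derivative f' x) (at x within {0..1})"
    "\<And>x. x \<in> {0..1} \<Longrightarrow> (f' has_real_derivative f'' x) (at x within {0..1})"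
    "\<And>x. x \<in> {0..1} \<Longrightarrow> f' x > 0" "\<And>x. x \<in> {0..1} \<Longrightarrow> f'' x < 0"
  using assms unfolding rise_function_def by blast

lemma has_real_derivative_interior:
  assumes "(f has_real_derivative D) (at x within {0..1})" "0 < x" "x < 1"
  shows "(f has_real_derivative D) (at x)"
proof -
  have "(f has_real_derivative D) (at x within {0<..<1})"
    using assms(1) by (rule DERIV_subset) auto
  then show ?thesis
    using assms(2,3) by (simp add: at_within_open[of x "{0<..<1}"])
qed

lemma rise_function_continuous:
  assumes "rise_function f"
  shows "continuous_on {0..1} f"
proof -
  obtain f' where "\<And>x. x \<in> {0..1} \<Longrightarrow> (f has_real_derivative f' x) (at x within {0..1})"
    using rise_functionE[OF assms] by metis
  then show ?thesis
    by (rule DERIV_continuous_on)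
qed

lemma rise_function_strict_mono:
  assumes "rise_function f"
  shows "strict_mono_on {0..1} f"
proof (rule strict_mono_onI)
  fix x y :: real
  assume xy: "x \<in> {0..1}" "y \<in> {0..1}" "x < y"
  obtain f' where d: "\<And>x. x \<in> {0..1} \<Longrightarrow> (f has_real_derivative f' x) (at x within {0..1})"
    and pos: "\<And>x. x \<in> {0..1} \<Longrightarrow> f' x > 0"
    using rise_functionE[OF assms] by metis
  show "f x < f y"
  proof (rule DERIV_pos_imp_increasing_open[OF \<open>x < y\<close>])
    fix z assume "x < z" "z < y"
    then show "\<exists>D. (f has_real_derivative D) (at z) \<and> D > 0"
      using xy d[of z] pos[of z] has_real_derivative_interior[of f "f' z" z] by auto
  next
    show "continuous_on {x..y} f"
      using rise_function_continuous[OF assms] by (rule continuous_on_subset) (use xy in auto)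
  qed
qed

lemma rise_function_surj:
  assumes "rise_function f"
  shows "f ` {0..1} = {0..1}"
proof
  show "f ` {0..1} \<subseteq> {0..1}"
    using assms by (simp add: rise_function_def)
  show "{0..1} \<subseteq> f ` {0..1}"
  proof
    fix y :: real
    assume y: "y \<in> {0..1}"
    have "f 0 = 0" "f 1 = 1"
      using assms by (auto simp: rise_function_def)
    with y have "\<exists>x\<ge>0. x \<le> 1 \<and> f x = y"
      by (intro IVT' rise_function_continuous[OF assms]) auto
    then show "y \<in> f ` {0..1}"
      by force
  qed
qed

text \<open>Since \<open>f'' < 0\<close>, \<open>f'\<close> decreases, so the increment over a fixed
  length \<open>d\<close> has negative derivative in its starting point. In this form concavity
  compares one stretch of drift started from two phases.\<close>

lemma rise_function_decreasing_increments:
  assumes "rise_function f" "0 \<le> x" "x \<le> u" "0 \<le> d" "u + d \<le> 1"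
  shows "f (u + d) - f u \<le> f (x + d) - f x"
proof (cases "x = u \<or> d = 0")
  case False
  then have xu: "x < u" "0 < d"
    using assms by auto
  obtain f' f'' where d1: "\<And>x. x \<in> {0..1} \<Longrightarrow> (f has_real_derivative f' x) (at x within {0..1})"
    and d2: "\<And>x. x \<in> {0..1} \<Longrightarrow> (f' has_real_derivative f'' x) (at x within {0..1})"
    and neg: "\<And>x. x \<in> {0..1} \<Longrightarrow> f'' x < 0"
    using rise_functionE[OF assms(1)] by metis
  have cf': "continuous_on {0..1} f'"
    using d2 by (rule DERIV_continuous_on)
  have dec: "f' b < f' a" if "a < b" "a \<in> {0..1}" "b \<in> {0..1}" for a b
  proof (rule DERIV_neg_imp_decreasing_open[OF \<open>a < b\<close>])
    fix z assume "a < z" "z < b"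
    then show "\<exists>D. (f' has_real_derivative D) (at z) \<and> D < 0"
      using that d2[of z] neg[of z] has_real_derivative_interior[of f' "f'' z" z] by auto
  next
    show "continuous_on {a..b} f'"
      using cf' by (rule continuous_on_subset) (use that in auto)
  qed
  let ?k = "\<lambda>z. f (z + d) - f z"
  have "?k u < ?k x"
  proof (rule DERIV_neg_imp_decreasing_open[OF \<open>x < u\<close>])
    fix z assume z: "x < z" "z < u"
    have "(f has_real_derivative f' (z + d)) (at (z + d))"
      using z assms xu by (intro has_real_derivative_interior d1) auto
    moreover have "(f has_real_derivative f' z) (at z)"
      using z assms xu by (intro has_real_derivative_interior d1) auto
    ultimately have "(?k has_real_derivative f' (z + d) - f' z) (at z)"
      by (auto intro!: DERIV_diff simp: DERIV_shift)
    moreover have "f' (z + d) < f' z"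
      using z assms xu by (intro dec) auto
    ultimately show "\<exists>D. (?k has_real_derivative D) (at z) \<and> D < 0"
      by force
  next
    note cont = rise_function_continuous[OF assms(1)]
    show "continuous_on {x..u} ?k"
      by (intro continuous_on_diff continuous_on_compose2[OF cont] continuous_intros
          continuous_on_subset[OF cont]) (use assms in auto)
  qed
  then show ?thesis
    by simp
qed auto

section \<open>Local finiteness of firing times\<close>

text \<open>Firings cannot accumulate: right limits are never 1, and a left limit 1 would clash with
  the drop towards 0 right after each firing. Compactness turns isolation into finiteness.\<close>

lemma finite_firing_times:
  fixes \<chi> :: "real \<Rightarrow> real"
  assumes right: "\<And>t. 0 \<le> t \<Longrightarrow> (\<chi> \<longlongrightarrow> (if \<chi> t = 1 then 0 else \<chi> t)) (at_right t)"
    and left: "\<And>t. 0 < t \<Longrightarrow> \<exists>l. (\<chi> \<longlongrightarrow> l) (at_left t)"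
  shows "finite {s. 0 \<le> s \<and> s \<le> b \<and> \<chi> s = 1}"
proof (cases "0 \<le> b")
  case True
  define S where "S = {s. 0 \<le> s \<and> \<chi> s = 1}"
  have iso_right: "\<exists>d>0. \<forall>s. x < s \<and> s < x + d \<longrightarrow> s \<notin> S" if "0 \<le> x" for x
  proof -
    have "eventually (\<lambda>s. \<chi> s \<noteq> 1) (at_right x)"
      by (rule tendsto_imp_eventually_ne[OF right[OF that]]) auto
    then obtain c where "c > x" "\<forall>s>x. s < c \<longrightarrow> \<chi> s \<noteq> 1"
      by (auto simp: eventually_at_right_field)
    then show ?thesis
      by (intro exI[of _ "c - x"]) (auto simp: S_def)
  qed
  have iso_left: "\<exists>d>0. \<forall>s. x - d < s \<and> s < x \<longrightarrow> s \<notin> S" if "0 \<le> x" for x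
  proof (cases "x = 0")
    case True
    then show ?thesis
      by (intro exI[of _ 1]) (auto simp: S_def)
  next
    case False
    then have "0 < x"
      using that by simp
    then obtain l where l: "(\<chi> \<longlongrightarrow> l) (at_left x)"
      using left by blast
    show ?thesis
    proof (cases "l = 1")
      case False
      have "eventually (\<lambda>s. \<chi> s \<noteq> 1) (at_left x)"
        by (rule tendsto_imp_eventually_ne[OF l False])
      then obtain c where "c < x" "\<forall>s>c. s < x \<longrightarrow> \<chi> s \<noteq> 1"
        by (auto simp: eventually_at_left_field)
      then show ?thesis
        by (intro exI[of _ "x - c"]) (auto simp: S_def)
    next
      \<comment> \<open>Values above 1/2 on a left neighbourhood of \<open>x\<close> exclude firings
        there, because each firing is followed at once by values below 1/2.\<close>
      case True
      have "eventually (\<lambda>s. \<chi> s > 1/2) (at_left x)"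
        using l True by (intro order_tendstoD(1)[OF l]) simp
      then obtain c where c: "c < x" "\<forall>s>c. s < x \<longrightarrow> \<chi> s > 1/2"
        by (auto simp: eventually_at_left_field)
      have "s \<notin> S" if s: "c < s" "s < x" for s
      proof
        assume "s \<in> S"
        then have "(\<chi> \<longlongrightarrow> 0) (at_right s)"
          using right[of s] by (simp add: S_def)
        then have "eventually (\<lambda>r. \<chi> r < 1/2) (at_right s)"
          by (rule order_tendstoD) simp
        then obtain e where "e > s" "\<forall>r>s. r < e \<longrightarrow> \<chi> r < 1/2"
          by (auto simp: eventually_at_right_field)
        moreover obtain r where "s < r" "r < min e x"
          using dense[of s "min e x"] \<open>e > s\<close> s by auto
        ultimately have "\<chi> r < 1/2" "\<chi> r > 1/2"
          using c s by auto
        then show False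
          by simp
      qed
      then show ?thesis
        using c by (intro exI[of _ "x - c"]) auto
    qed
  qed
  \<comment> \<open>By bisection only short intervals around a point \<open>x\<close> need checking,
    and these contain no firing except possibly \<open>x\<close>.\<close>
  have "finite (S \<inter> {0..b})"
  proof (induction rule: Bolzano[OF True, consumes 0, case_names trans local])
    case (trans p q r)
    then have "{p..r} = {p..q} \<union> {q..r}"
      by (simp add: ivl_disj_un_two_touch)
    with trans show ?case
      by (simp add: Int_Un_distrib)
  next
    case (local x)
    obtain d1 d2 where d: "d1 > 0" "\<forall>s. x < s \<and> s < x + d1 \<longrightarrow> s \<notin> S"
      "d2 > 0" "\<forall>s. x - d2 < s \<and> s < x \<longrightarrow> s \<notin> S"
      using iso_right iso_left local by metis
    have "S \<inter> {p..q} \<subseteq> {x}" if "p \<le> x \<and> x \<le> q \<and> q - p < min d1 d2" for p q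
    proof
      fix s assume s: "s \<in> S \<inter> {p..q}"
      then have "\<not> (x < s \<and> s < x + d1)" "\<not> (x - d2 < s \<and> s < x)"
        using d by auto
      with s that show "s \<in> {x}"
        by auto
    qed
    then show ?case
      using d by (intro exI[of _ "min d1 d2"]) (auto intro: finite_subset)
  qed
  moreover have "{s. 0 \<le> s \<and> s \<le> b \<and> \<chi> s = 1} = S \<inter> {0..b}"
    by (auto simp: S_def)
  ultimately show ?thesis
    by simp
qed (auto intro: finite_subset[of _ "{}"])

section \<open>The common phase of a synchronized population\<close>

text \<open>Synchrony holds from time \<open>T - \<tau>\<close> on, so that the spikes arriving after \<open>T\<close> are those emitted
  synchronously.\<close>

locale synchronized_phase =
  fixes f :: "real \<Rightarrow> real" and \<tau> \<epsilon> T :: real and \<psi> :: "real \<Rightarrow> real"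
  assumes rise: "rise_function f"
    and tau: "0 < \<tau>" "\<tau> < 1"
    and eps: "0 < \<epsilon>" "f \<tau> + \<epsilon> < 1"
    and T: "\<tau> \<le> T"
    and range: "\<And>t. 0 \<le> t \<Longrightarrow> 0 \<le> \<psi> t \<and> \<psi> t \<le> 1"
    and left_limit: "\<And>t. 0 < t \<Longrightarrow> \<exists>l. (\<psi> \<longlongrightarrow> l) (at_left t)"
    and right_limit: "\<And>t. 0 \<le> t \<Longrightarrow> (\<psi> \<longlongrightarrow> (if \<psi> t = 1 then 0 else \<psi> t)) (at_right t)"
    and drift: "\<And>t. T < t \<Longrightarrow> \<psi> t \<noteq> 1 \<Longrightarrow> \<psi> (t - \<tau>) \<noteq> 1 \<Longrightarrow> (\<psi> has_real_derivative 1) (at t)"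
    and jump: "\<And>t l. T < t \<Longrightarrow> (\<psi> \<longlongrightarrow> l) (at_left t) \<Longrightarrow> 0 \<le> l \<Longrightarrow> l \<le> 1 \<Longrightarrow>
      f (\<psi> t) = min 1 (f l + (if \<psi> (t - \<tau>) = 1 then \<epsilon> else 0))"
begin

section \<open>Order properties of the rise function and motion between events\<close>

lemma f_0: "f 0 = 0" and f_1: "f 1 = 1"
  using rise by (auto simp: rise_function_def)

lemma f_less: "0 \<le> x \<Longrightarrow> x < y \<Longrightarrow> y \<le> 1 \<Longrightarrow> f x < f y"
  using strict_mono_onD[OF rise_function_strict_mono[OF rise], of x y] by auto

lemma f_le: "0 \<le> x \<Longrightarrow> x \<le> y \<Longrightarrow> y \<le> 1 \<Longrightarrow> f x \<le> f y"
  using f_less[of x y] by (cases "x = y") auto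

lemma f_inj: "x \<in> {0..1} \<Longrightarrow> y \<in> {0..1} \<Longrightarrow> f x = f y \<Longrightarrow> x = y"
  using f_less[of x y] f_less[of y x] by force

lemma finite_firings: "finite {s. 0 \<le> s \<and> s \<le> b \<and> \<psi> s = 1}"
  by (rule finite_firing_times[OF right_limit left_limit])

text \<open>Integrated form of \<open>drift\<close> and \<open>jump\<close>. The start value is a
  right limit, so that it covers a reset (\<open>v = 0\<close>) as well as a phase just raised by a
  spike. The bound by 1 limits the length of a quiet stretch.\<close>

lemma drift_between:
  assumes "T \<le> a" "a < b"
    and quiet: "\<And>t. a < t \<Longrightarrow> t < b \<Longrightarrow> \<psi> t \<noteq> 1 \<and> \<psi> (t - \<tau>) \<noteq> 1"
    and v: "(\<psi> \<longlongrightarrow> v) (at_right a)"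
  shows "(\<psi> \<longlongrightarrow> v + (b - a)) (at_left b)" "0 \<le> v + (b - a)" "v + (b - a) \<le> 1"
    "f (\<psi> b) = min 1 (f (v + (b - a)) + (if \<psi> (b - \<tau>) = 1 then \<epsilon> else 0))"
proof -
  let ?h = "\<lambda>t. \<psi> t - t"
  \<comment> \<open>\<open>?h\<close> is constant on the quiet interval; the midpoint is an
    arbitrary sample point.\<close>
  define C where "C = ?h ((a + b) / 2)"
  have "?h t = C" if "t \<in> {a<..<b}" for t
    unfolding C_def
  proof (rule DERIV_isconst3[of a b _ _ ?h])
    fix x assume "x \<in> {a<..<b}"
    then have "(\<psi> has_real_derivative 1) (at x)"
      using quiet[of x] assms by (intro drift) auto
    from DERIV_diff[OF this DERIV_ident] show "(?h has_real_derivative 0) (at x)"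
      by simp
  qed (use assms that in auto)
  then have h: "\<psi> t = C + t" if "t \<in> {a<..<b}" for t
    using that by (simp add: algebra_simps)
  have "((\<lambda>t. C + t) \<longlongrightarrow> C + a) (at_right a)"
    by (intro tendsto_intros)
  moreover have "eventually (\<lambda>t. C + t = \<psi> t) (at_right a)"
    using h \<open>a < b\<close> by (auto simp: eventually_at_right_field)
  ultimately have "(\<psi> \<longlongrightarrow> C + a) (at_right a)"
    by (rule Lim_transform_eventually)
  then have C: "C + b = v + (b - a)"
    using tendsto_unique[OF _ v] by fastforce
  have "((\<lambda>t. C + t) \<longlongrightarrow> C + b) (at_left b)"
    by (intro tendsto_intros)
  moreover have "eventually (\<lambda>t. C + t = \<psi> t) (at_left b)"
    using h \<open>a < b\<close> by (auto simp: eventually_at_left_field)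
  ultimately have "(\<psi> \<longlongrightarrow> C + b) (at_left b)"
    by (rule Lim_transform_eventually)
  then show l: "(\<psi> \<longlongrightarrow> v + (b - a)) (at_left b)"
    by (simp only: C)
  have "eventually (\<lambda>t. 0 \<le> \<psi> t \<and> \<psi> t \<le> 1) (at_left b)"
    using assms tau T range by (auto simp: eventually_at_left_field intro!: exI[of _ a])
  then show r: "0 \<le> v + (b - a)" "v + (b - a) \<le> 1"
    by (intro tendsto_lowerbound[OF l] tendsto_upperbound[OF l]; simp add: eventually_conj_iff)+
  show "f (\<psi> b) = min 1 (f (v + (b - a)) + (if \<psi> (b - \<tau>) = 1 then \<epsilon> else 0))"
    using assms by (intro jump l r) auto
qed

text \<open>Without firings after \<open>a\<close> no spike arrives after \<open>a + \<tau>\<close>,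
  and free drift would carry the phase past 1.\<close>

lemma firing_after:
  assumes "T \<le> a"
  shows "\<exists>s>a. \<psi> s = 1"
proof (rule ccontr)
  assume "\<not> ?thesis"
  then have no: "\<psi> s \<noteq> 1" if "s > a" for s
    using that by blast
  let ?a = "a + \<tau>"
  have "(\<psi> \<longlongrightarrow> \<psi> ?a) (at_right ?a)"
    using right_limit[of ?a] no[of ?a] tau T assms by simp
  \<comment> \<open>The stretch up to \<open>a + 2\<close> has length
    \<open>2 - \<tau> > 1\<close>.\<close>
  then have "\<psi> ?a + ((?a + 2) - ?a) \<le> 1"
    using assms tau by (intro drift_between) (auto intro!: no)
  moreover have "0 \<le> \<psi> ?a"
    using range[of ?a] tau T assms by simp
  ultimately show False
    by simp
qed

section \<open>Successive firings and spikes in flight\<close>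

definition successive :: "real \<Rightarrow> real \<Rightarrow> bool" where
  "successive s s' \<longleftrightarrow> s < s' \<and> \<psi> s = 1 \<and> \<psi> s' = 1 \<and> (\<forall>t. s < t \<and> t < s' \<longrightarrow> \<psi> t \<noteq> 1)"

lemma successive_exists:
  assumes "T \<le> s" "\<psi> s = 1"
  shows "\<exists>s'. successive s s'"
proof -
  obtain r where r: "s < r" "\<psi> r = 1"
    using firing_after[OF assms(1)] by blast
  let ?R = "{t. s < t \<and> t \<le> r \<and> \<psi> t = 1}"
  have fin: "finite ?R"
    by (rule finite_subset[OF _ finite_firings[of r]]) (use assms tau T in auto)
  have "Min ?R \<in> ?R"
    by (rule Min_in[OF fin]) (use r in auto)
  moreover have "\<psi> t \<noteq> 1" if "s < t" "t < Min ?R" for t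
  proof
    assume "\<psi> t = 1"
    with that \<open>Min ?R \<in> ?R\<close> have "t \<in> ?R"
      by auto
    from Min_le[OF fin this] that show False
      by simp
  qed
  ultimately show ?thesis
    unfolding successive_def using assms by blast
qed

text \<open>The phase restarts from 0 at \<open>s\<close>. With at most one spike, \<open>f\<close>
  of the phase reaches at most
  \<open>f (s' - s) + \<epsilon> \<le> f \<tau> + \<epsilon> < 1\<close> at \<open>s'\<close>, too
  little to fire.\<close>

lemma short_gap_spikes:
  assumes "T \<le> s" and succ: "successive s s'" and gap: "s' - s \<le> \<tau>"
  shows "\<exists>a a'. s < a \<and> a < a' \<and> a' \<le> s' \<and> \<psi> (a - \<tau>) = 1 \<and> \<psi> (a' - \<tau>) = 1"
proof (rule ccontr)
  assume no: "\<not> ?thesis"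
  have fire: "\<psi> s = 1" "\<psi> s' = 1" "s < s'"
    and between: "\<And>t. s < t \<Longrightarrow> t < s' \<Longrightarrow> \<psi> t \<noteq> 1"
    using succ by (auto simp: successive_def)
  have v: "(\<psi> \<longlongrightarrow> 0) (at_right s)"
    using right_limit[of s] fire tau T assms by simp
  show False
  proof (cases "\<exists>a. s < a \<and> a < s' \<and> \<psi> (a - \<tau>) = 1")
    \<comment> \<open>One spike may still arrive at \<open>s'\<close> itself.\<close>
    case False
    then have "f (\<psi> s') = min 1 (f (0 + (s' - s)) + (if \<psi> (s' - \<tau>) = 1 then \<epsilon> else 0))"
      by (intro drift_between v) (use fire assms between in auto)
    then have "1 \<le> f (s' - s) + \<epsilon>"
      using fire f_1 eps by (auto split: if_splits)
    moreover have "f (s' - s) \<le> f \<tau>"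
      using fire gap tau by (intro f_le) auto
    ultimately show False
      using eps by simp
  next
    case True
    then obtain a where a: "s < a" "a < s'" "\<psi> (a - \<tau>) = 1"
      by blast
    have other: "\<psi> (t - \<tau>) \<noteq> 1" if "s < t" "t \<le> s'" "t \<noteq> a" for t
      using no a that by (metis less_imp_le linorder_neqE)
    have fa: "f (\<psi> a) = min 1 (f (0 + (a - s)) + (if \<psi> (a - \<tau>) = 1 then \<epsilon> else 0))"
      by (intro drift_between v) (use a assms between other in auto)
    have ra: "0 \<le> \<psi> a" "\<psi> a \<le> 1" "\<psi> a \<noteq> 1"
      using range[of a] a assms tau T between[of a] by auto
    \<comment> \<open>No firing occurs at \<open>a\<close>, so the cap at 1 is not reached
      there.\<close>
    have fa': "f (\<psi> a) = f (a - s) + \<epsilon>"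
      using fa a f_less[of "\<psi> a" 1] ra f_1 by (simp add: min_def split: if_splits)
    \<comment> \<open>This orders the two starting phases for the concavity comparison
      below.\<close>
    have "a - s \<le> \<psi> a"
    proof (rule ccontr)
      assume "\<not> ?thesis"
      then have "f (\<psi> a) < f (a - s)"
        using ra a gap tau by (intro f_less) auto
      with fa' eps show False
        by simp
    qed
    have "(\<psi> \<longlongrightarrow> \<psi> a) (at_right a)"
      using right_limit[of a] ra a tau T assms by simp
    note db = drift_between[OF _ a(2) _ this]
    have q: "\<psi> t \<noteq> 1 \<and> \<psi> (t - \<tau>) \<noteq> 1" if "a < t" "t < s'" for t
      using that between[of t] other[of t] a by auto
    have "T \<le> a"
      using a assms by simp
    note db = db[OF this q]
    have "f (\<psi> a + (s' - a)) = 1"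
      using db(4) db(2,3) fire f_1 other[of s'] a f_le[of "\<psi> a + (s' - a)" 1]
      by (auto simp: min_def split: if_splits)
    then have "\<psi> a + (s' - a) = 1"
      using f_inj[of "\<psi> a + (s' - a)" 1] db(2,3) f_1 by simp
    \<comment> \<open>Receiving the spike at \<open>a\<close> raises \<open>f\<close> at \<open>s'\<close> no more than receiving it at \<open>s'\<close> itself.\<close>
    moreover have "f (\<psi> a + (s' - a)) - f (\<psi> a) \<le> f ((a - s) + (s' - a)) - f (a - s)"
      using a db(3) \<open>a - s \<le> \<psi> a\<close> by (intro rise_function_decreasing_increments[OF rise]) auto
    ultimately have "1 \<le> f (s' - s) + \<epsilon>"
      using fa' f_1 by simp
    moreover have "f (s' - s) \<le> f \<tau>"
      using fire gap tau by (intro f_le) auto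
    ultimately show False
      using eps by simp
  qed
qed

text \<open>The measure counts the spikes in flight at \<open>s\<close>, including the one just
  emitted. A short gap uses up at least two and adds one, so short gaps cannot continue
  forever.\<close>

lemma long_gap_exists:
  assumes "T \<le> s" "\<psi> s = 1"
  shows "\<exists>r r'. T \<le> r \<and> successive r r' \<and> \<tau> < r' - r"
  using assms
proof (induction "card {r. s - \<tau> < r \<and> r \<le> s \<and> \<psi> r = 1}" arbitrary: s rule: less_induct)
  case less
  let ?W = "\<lambda>s. {r. s - \<tau> < r \<and> r \<le> s \<and> \<psi> r = 1}"
  obtain s' where succ: "successive s s'"
    using successive_exists less.prems by blast
  show ?case
  proof (cases "\<tau> < s' - s")
    case True
    then show ?thesis
      using succ less.prems by blast
  next
    case False
    then obtain a a' where a: "s < a" "a < a'" "a' \<le> s'" "\<psi> (a - \<tau>) = 1" "\<psi> (a' - \<tau>) = 1"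
      using short_gap_spikes[OF less.prems(1) succ] by auto
    have fin: "finite (?W s)"
      by (rule finite_subset[OF _ finite_firings[of s]]) (use less.prems T in auto)
    \<comment> \<open>Both emissions lie after \<open>s - \<tau>\<close> because
      \<open>a > s\<close>, and not after \<open>s\<close> because
      \<open>a' \<le> s' \<le> s + \<tau>\<close>.\<close>
    have in_W: "{a - \<tau>, a' - \<tau>} \<subseteq> ?W s"
      using a False by auto
    \<comment> \<open>Both spikes have arrived by \<open>s'\<close>, so they leave the window; its
      only possible new member is \<open>s'\<close>.\<close>
    have "?W s' \<subseteq> insert s' (?W s - {a - \<tau>, a' - \<tau>})"
    proof
      fix r assume r: "r \<in> ?W s'"
      then have "\<not> (s < r \<and> r < s')"
        using succ by (auto simp: successive_def)
      with r a show "r \<in> insert s' (?W s - {a - \<tau>, a' - \<tau>})"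
        by auto
    qed
    then have "card (?W s') \<le> card (insert s' (?W s - {a - \<tau>, a' - \<tau>}))"
      using fin by (intro card_mono) auto
    also have "\<dots> \<le> Suc (card (?W s - {a - \<tau>, a' - \<tau>}))"
      by (rule card_insert_le_m1) auto
    also have "card (?W s - {a - \<tau>, a' - \<tau>}) = card (?W s) - 2"
      using in_W a by (subst card_Diff_subset) auto
    finally have le: "card (?W s') \<le> Suc (card (?W s) - 2)" .
    \<comment> \<open>This keeps the natural-number subtraction from truncating.\<close>
    moreover have "2 \<le> card (?W s)"
      using card_mono[OF fin in_W] a by simp
    ultimately have "card (?W s') < card (?W s)"
      by linarith
    moreover have "T \<le> s'" "\<psi> s' = 1"
      using succ less.prems by (auto simp: successive_def)
    ultimately show ?thesis
      using less.hyps by blast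
  qed
qed

text \<open>The gap splits into \<open>\<tau>\<close> until the spike from \<open>s\<close> arrives
  and \<open>1 - c\<close> after its jump to phase \<open>c\<close>; spikes emitted before
  \<open>s\<close> have already arrived by time \<open>s\<close>.\<close>

lemma gap_after_long_gap:
  assumes "T \<le> s" "successive r s" "\<tau> < s - r" "successive s s'"
    and c: "c \<in> {0..1}" "f c = f \<tau> + \<epsilon>"
  shows "s' - s = \<tau> + 1 - c"
proof -
  have clean: "\<psi> t \<noteq> 1" if "s - \<tau> < t" "t < s" for t
    using assms that by (auto simp: successive_def)
  have fire: "\<psi> s = 1" "\<psi> s' = 1" "s < s'"
    and between: "\<And>t. s < t \<Longrightarrow> t < s' \<Longrightarrow> \<psi> t \<noteq> 1"
    using assms by (auto simp: successive_def)
  \<comment> \<open>A short gap would need two arrivals in \<open>(s, s + \<tau>]\<close>. The later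
    may come from the firing at \<open>s\<close>, but the earlier was emitted strictly between
    \<open>s - \<tau>\<close> and \<open>s\<close>, where there is no firing.\<close>
  have gap: "\<tau> < s' - s"
  proof (rule ccontr)
    assume "\<not> ?thesis"
    then obtain a a' where a: "s < a" "a < a'" "a' \<le> s'" "\<psi> (a - \<tau>) = 1" "\<psi> (a' - \<tau>) = 1"
      using short_gap_spikes assms by fastforce
    then have "a - \<tau> < s"
      using \<open>\<not> \<tau> < s' - s\<close> by linarith
    then show False
      using clean[of "a - \<tau>"] a by auto
  qed
  let ?p = "s + \<tau>"
  have "(\<psi> \<longlongrightarrow> 0) (at_right s)"
    using right_limit[of s] fire tau T assms by simp
  then have "f (\<psi> ?p) = min 1 (f (0 + (?p - s)) + (if \<psi> (?p - \<tau>) = 1 then \<epsilon> else 0))"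
    by (intro drift_between) (use assms tau gap between clean in auto)
  then have "f (\<psi> ?p) = f c"
    using c eps fire by simp
  moreover have rp: "\<psi> ?p \<in> {0..1}" "\<psi> ?p \<noteq> 1"
    using range[of ?p] assms tau T between[of ?p] gap by auto
  ultimately have pc: "\<psi> ?p = c"
    using f_inj c by blast
  then have "(\<psi> \<longlongrightarrow> c) (at_right ?p)"
    using right_limit[of ?p] rp tau T assms by auto
  note db = drift_between[OF _ _ _ this, of s']
  \<comment> \<open>A spike arriving after \<open>s + \<tau>\<close> but before \<open>s'\<close>
    would have been emitted strictly between the two firings.\<close>
  have q: "\<psi> t \<noteq> 1 \<and> \<psi> (t - \<tau>) \<noteq> 1" if "?p < t" "t < s'" for t
    using that between[of t] between[of "t - \<tau>"] tau by auto
  have "T \<le> ?p" "?p < s'"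
    using assms tau gap by auto
  note db = db[OF this q]
  have "\<psi> (s' - \<tau>) \<noteq> 1"
    using between[of "s' - \<tau>"] tau gap by auto
  then have "f (c + (s' - ?p)) = 1"
    using db(4) db(2,3) fire f_1 f_le[of "c + (s' - ?p)" 1] by simp
  then have "c + (s' - ?p) = 1"
    using f_inj[of "c + (s' - ?p)" 1] db(2,3) f_1 by simp
  then show ?thesis
    by simp
qed

text \<open>Since \<open>c < 1\<close>, the gap \<open>\<tau> + 1 - c\<close> is again longer than
  \<open>\<tau>\<close>, so the hypothesis of \<open>gap_after_long_gap\<close> reproduces
  itself.\<close>

lemma eventually_equidistant_firings:
  "\<exists>s0 \<Delta>. T \<le> s0 \<and> 0 < \<Delta> \<and> (\<forall>k::nat. successive (s0 + real k * \<Delta>) (s0 + real (Suc k) * \<Delta>))"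
proof -
  have "0 \<le> f \<tau>"
    using f_le[of 0 \<tau>] f_0 tau by simp
  then have "f \<tau> + \<epsilon> \<in> f ` {0..1}"
    using rise_function_surj[OF rise] eps by simp
  then obtain c where c: "c \<in> {0..1}" "f c = f \<tau> + \<epsilon>"
    by auto
  then have "c \<noteq> 1"
    using eps f_1 by auto
  define \<Delta> where "\<Delta> = \<tau> + 1 - c"
  have \<Delta>: "\<tau> < \<Delta>" "0 < \<Delta>"
    using c \<open>c \<noteq> 1\<close> tau by (auto simp: \<Delta>_def)
  obtain s where "s > T" "\<psi> s = 1"
    using firing_after[of T] by blast
  then obtain r s0 where r: "T \<le> r" "successive r s0" "\<tau> < s0 - r"
    using long_gap_exists[of s] by auto
  \<comment> \<open>The first long gap need not have length \<open>\<Delta>\<close>, so the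
    predecessor \<open>r\<close> is only required to be more than \<open>\<tau>\<close>
    earlier.\<close>
  have "\<exists>r. successive r (s0 + real k * \<Delta>) \<and> \<tau> < s0 + real k * \<Delta> - r \<and>
      successive (s0 + real k * \<Delta>) (s0 + real (Suc k) * \<Delta>)" for k :: nat
  proof (induction k)
    case 0
    obtain s' where s': "successive s0 s'"
      using successive_exists[of s0] r by (auto simp: successive_def)
    then have "s' - s0 = \<Delta>"
      unfolding \<Delta>_def using r c by (intro gap_after_long_gap) (auto simp: successive_def)
    then have "s' = s0 + \<Delta>"
      by simp
    then show ?case
      using r s' by auto
  next
    case (Suc k)
    let ?s = "s0 + real (Suc k) * \<Delta>"
    have succ: "successive (s0 + real k * \<Delta>) ?s"
      using Suc by blast
    have "T \<le> s0" "0 \<le> real (Suc k) * \<Delta>"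
      using r \<Delta> by (auto simp: successive_def)
    then have "T \<le> ?s"
      by linarith
    have long: "\<tau> < ?s - (s0 + real k * \<Delta>)"
      using \<Delta> by (simp add: algebra_simps)
    obtain s' where s': "successive ?s s'"
      using successive_exists[OF \<open>T \<le> ?s\<close>] succ by (auto simp: successive_def)
    then have "s' - ?s = \<Delta>"
      unfolding \<Delta>_def using succ long \<open>T \<le> ?s\<close> c
      by (intro gap_after_long_gap) (auto simp: \<Delta>_def)
    then have "s' = s0 + real (Suc (Suc k)) * \<Delta>"
      by (simp add: algebra_simps)
    then show ?case
      using succ long s' by auto
  qed
  moreover have "T \<le> s0"
    using r by (auto simp: successive_def)
  ultimately show ?thesis
    using \<Delta> by blast
qed

end

section \<open>Reduction to the common phase\<close>

text \<open>Spikes arriving after \<open>T + \<tau>\<close> were emitted when all oscillators fire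
  together. Each oscillator then receives all its incoming spikes or none, and the network enters
  only through the common total \<open>\<epsilon>\<close>.\<close>

lemma synchronized_phase_of_pulse_solution:
  fixes Pre :: "'n::finite \<Rightarrow> 'n set"
  assumes rise: "rise_function f" and tau: "0 < \<tau>" "\<tau> < 1"
    and eps: "0 < \<epsilon>" "f \<tau> + \<epsilon> < 1"
    and strength: "\<And>i. (\<Sum>j\<in>Pre i. eps j i) = \<epsilon>"
    and sol: "pulse_solution f \<tau> Pre eps \<phi>"
    and T: "0 \<le> T" and sync: "\<And>i j t. T \<le> t \<Longrightarrow> \<phi> i t = \<phi> j t"
  shows "synchronized_phase f \<tau> \<epsilon> (T + \<tau>) (\<phi> i)"
proof -
  have Pre: "Pre i \<noteq> {}"
    using strength[of i] eps by auto
  have arr: "arriving Pre \<tau> \<phi> i t = (if \<phi> i (t - \<tau>) = 1 then Pre i else {})" if "T + \<tau> < t" for t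
  proof -
    have "fires \<phi> j (t - \<tau>) \<longleftrightarrow> \<phi> i (t - \<tau>) = 1" for j
      using that T sync[of "t - \<tau>" j i] by (auto simp: fires_def)
    then show ?thesis
      by (simp add: arriving_def)
  qed
  \<comment> \<open>Since \<open>f\<close> maps \<open>{0..1}\<close> bijectively onto itself, the
    jump clause becomes an equation for \<open>f (\<phi> i t)\<close>.\<close>
  have inv: "f (the_inv_into {0..1} f y) = y" if "0 \<le> y" "y \<le> 1" for y
  proof (rule f_the_inv_into_f)
    show "inj_on f {0..1}"
      using rise_function_strict_mono[OF rise] by (rule strict_mono_on_imp_inj_on)
    show "y \<in> f ` {0..1}"
      using rise_function_surj[OF rise] that by simp
  qed
  show ?thesis
  proof
    show "\<exists>l. (\<phi> i \<longlongrightarrow> l) (at_left t)" if "0 < t" for t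
      using sol that unfolding pulse_solution_def by blast
    show "(\<phi> i \<longlongrightarrow> (if \<phi> i t = 1 then 0 else \<phi> i t)) (at_right t)" if "0 \<le> t" for t
      using sol that unfolding pulse_solution_def fires_def by auto
    show "(\<phi> i has_real_derivative 1) (at t)"
      if "T + \<tau> < t" "\<phi> i t \<noteq> 1" "\<phi> i (t - \<tau>) \<noteq> 1" for t
      using sol that T tau arr[of t] unfolding pulse_solution_def fires_def by auto
    show "f (\<phi> i t) = min 1 (f l + (if \<phi> i (t - \<tau>) = 1 then \<epsilon> else 0))"
      if t: "T + \<tau> < t" and l: "(\<phi> i \<longlongrightarrow> l) (at_left t)" "0 \<le> l" "l \<le> 1" for t l
    proof -
      have "0 < t"
        using t T tau by simp
      then obtain l' where l': "(\<phi> i \<longlongrightarrow> l') (at_left t)"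
        "\<phi> i t = the_inv_into {0..1} f (min 1 (f l' + (\<Sum>j\<in>arriving Pre \<tau> \<phi> i t. eps j i)))"
        using sol unfolding pulse_solution_def by blast
      \<comment> \<open>The jump clause only asserts that some left limit exists; uniqueness
        identifies it with the given one.\<close>
      have "l' = l"
        using tendsto_unique[OF _ l'(1) l(1)] by simp
      moreover have "(\<Sum>j\<in>arriving Pre \<tau> \<phi> i t. eps j i) = (if \<phi> i (t - \<tau>) = 1 then \<epsilon> else 0)"
        using arr[OF t] strength by simp
      moreover have "0 \<le> f l"
        using rise l by (force simp: rise_function_def)
      ultimately show ?thesis
        using l'(2) eps by (simp add: inv)
    qed
  qed (use assms sol in \<open>auto simp: pulse_solution_def\<close>)
qed

section \<open>Numbering the firings of each oscillator\<close>

lemma is_firing_time_next: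
  assumes "is_firing_time \<phi> i m s" "fires \<phi> i s'" "s < s'"
    and "\<And>t. s < t \<Longrightarrow> t < s' \<Longrightarrow> \<not> fires \<phi> i t"
  shows "is_firing_time \<phi> i (Suc m) s'"
proof -
  have eq: "{t. t \<le> s' \<and> fires \<phi> i t} = insert s' {t. t \<le> s \<and> fires \<phi> i t}"
  proof (intro set_eqI iffI)
    fix t assume t: "t \<in> {t. t \<le> s' \<and> fires \<phi> i t}"
    then have "\<not> (s < t \<and> t < s')"
      using assms(4) by blast
    with t show "t \<in> insert s' {t. t \<le> s \<and> fires \<phi> i t}"
      by auto
  qed (use assms in auto)
  show ?thesis
    using assms unfolding is_firing_time_def eq by auto
qed

theorem mainTheorem5:
  fixes f :: "real \<Rightarrow> real"
    and \<tau> \<epsilon> :: real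
    and Pre :: "'n::finite \<Rightarrow> 'n set"
    and eps :: "'n \<Rightarrow> 'n \<Rightarrow> real"
    and \<phi> :: "'n \<Rightarrow> real \<Rightarrow> real"
  assumes "rise_function f"
    and "0 < \<tau>" and "\<tau> < 1"
    and "0 < \<epsilon>" and "\<epsilon> < 1"
    and "\<And>i. i \<notin> Pre i"
    and "\<And>i j. j \<in> Pre i \<Longrightarrow> eps j i > 0"
    and "\<And>i. (\<Sum>j\<in>Pre i. eps j i) = \<epsilon>"
    and "f \<tau> + \<epsilon> < 1"
    and "pulse_solution f \<tau> Pre eps \<phi>"
    and "completely_synchronized \<phi>"
  shows "period_solution 1 \<phi>"
proof -
  obtain T where T: "0 \<le> T" and sync: "\<And>i j t. T \<le> t \<Longrightarrow> \<phi> i t = \<phi> j t"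
    using assms(11) unfolding completely_synchronized_def by blast
  have phase: "synchronized_phase f \<tau> \<epsilon> (T + \<tau>) (\<phi> i)" for i
    using assms T sync by (intro synchronized_phase_of_pulse_solution) auto
  \<comment> \<open>\<open>undefined\<close> is an arbitrary representative oscillator.\<close>
  interpret synchronized_phase f \<tau> \<epsilon> "T + \<tau>" "\<phi> undefined"
    by (rule phase)
  obtain s0 \<Delta> where s0: "T + \<tau> \<le> s0" and \<Delta>: "0 < \<Delta>"
    and succ: "\<And>k. successive (s0 + real k * \<Delta>) (s0 + real (Suc k) * \<Delta>)"
    using eventually_equidistant_firings by blast
  have late: "T \<le> s0 + real k * \<Delta>" for k
  proof -
    have "0 \<le> real k * \<Delta>"
      using \<Delta> by simp
    then show ?thesis
      using s0 tau by linarith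
  qed
  have fires: "fires \<phi> i t \<longleftrightarrow> \<phi> undefined t = 1" if "T \<le> t" for i t
    using sync[OF that, of i undefined] T that by (auto simp: fires_def)
  \<comment> \<open>Before synchronization the oscillators may have fired different numbers of
    times, so the common firing at \<open>s0\<close> has an index depending on
    \<open>i\<close>.\<close>
  define m where "m i = card {s. s \<le> s0 \<and> fires \<phi> i s}" for i
  have firing: "is_firing_time \<phi> i (m i + k) (s0 + real k * \<Delta>)" for i k
  proof (induction k)
    case 0
    have "{s. s \<le> s0 \<and> fires \<phi> i s} = {s. 0 \<le> s \<and> s \<le> s0 \<and> \<phi> i s = 1}"
      by (auto simp: fires_def)
    then have "finite {s. s \<le> s0 \<and> fires \<phi> i s}"
      using synchronized_phase.finite_firings[OF phase[of i], of s0] by simp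
    moreover have "fires \<phi> i s0"
      using succ[of 0] late[of 0] fires by (simp add: successive_def)
    ultimately show ?case
      by (simp add: is_firing_time_def m_def)
  next
    case (Suc k)
    have "is_firing_time \<phi> i (Suc (m i + k)) (s0 + real (Suc k) * \<Delta>)"
    proof (rule is_firing_time_next[OF Suc])
      show "fires \<phi> i (s0 + real (Suc k) * \<Delta>)"
        using succ[of k] fires[OF late[of "Suc k"]] by (simp add: successive_def)
      show "s0 + real k * \<Delta> < s0 + real (Suc k) * \<Delta>"
        using \<Delta> by simp
      show "\<not> fires \<phi> i t" if "s0 + real k * \<Delta> < t" "t < s0 + real (Suc k) * \<Delta>" for t
        using succ[of k] fires[of t i] late[of k] that by (auto simp: successive_def)
    qed
    then show ?case
      by simp
  qed
  \<comment> \<open>There are finitely many oscillators, so one bound serves all; \<open>Suc\<close>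
    makes it positive.\<close>
  define M where "M = Suc (Max (range m))"
  have M: "m i \<le> M" for i
    unfolding M_def by (intro le_SucI Max_ge) auto
  have "\<exists>t t'. is_firing_time \<phi> i n t \<and> is_firing_time \<phi> i (n + 1) t' \<and> t' - t = \<Delta>"
    if n: "M \<le> n" for i n
  proof -
    obtain k where "n = m i + k"
      using le_Suc_ex[OF order_trans[OF M[of i] n]] by blast
    then have "is_firing_time \<phi> i n (s0 + real k * \<Delta>)"
      "is_firing_time \<phi> i (n + 1) (s0 + real (Suc k) * \<Delta>)"
      using firing[of i k] firing[of i "Suc k"] by simp_all
    moreover have "s0 + real (Suc k) * \<Delta> - (s0 + real k * \<Delta>) = \<Delta>"
      by (simp add: algebra_simps)
    ultimately show ?thesis
      by blast
  qed
  moreover have "M > 0"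
    by (simp add: M_def)
  ultimately show ?thesis
    unfolding period_solution_def using \<Delta> by (intro conjI exI[of _ \<Delta>] exI[of _ M]) auto
qed

end
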